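(* Let $n\ge2$. The representation $\hat{\rho}_B: C_n\to GL_n(\mathbb{Z}[t^{\pm1}])$ is reducible.
   Context: Let $\mathbb{F}_n$ be the free group on $x_1,\ldots,x_n$. The group $C_n$ of conjugating automorphisms is the subgroup of $\mathrm{Aut}(\mathbb{F}_n)$ of all automorphisms $\phi$ such that $\phi(x_i)=f_i^{-1}x_{\Pi(i)}f_i$ for all $i$, for some permutation $\Pi$ of $\{1,\ldots,n\}$ and some $f_i\in\mathbb{F}_n$. It is generated by the automorphisms $\epsilon_{ij}$, $1\le i\ne j\le n$, where $\epsilon_{ij}(x_i)=x_j^{-1}x_ix_j$ and $\epsilon_{ij}(x_l)=x_l$ for $l\ne i$, together with $\alpha_i$, $1\le i\le n-1$, where $\alpha_i$ swaps $x_i$ and $x_{i+1}$ and fixes the other generators. Products of automorphisms are taken in the right-action convention: $\phi\psi$ means first apply $\phi$, then $\psi$. Let $t$ be an indeterminate. The representation $\hat{\rho}_B:C_n\to GL_n(\mathbb{Z}[t^{\pm1}])$ (Bardakov's extension of the Burau representation) is the homomorphism such that: for $i\ne j$, $\hat{\rho}_B(\epsilon_{ij})$ is the matrix that agrees with the identity matrix except in row $i$, where the $(i,i)$ entry is $t^{-1}$, the $(i,j)$ entry is $1-t^{-1}$, and all other entries are $0$; and $\hat{\rho}_B(\alpha_i)$ is the permutation matrix of the transposition $(i\ \ i+1)$. (These assignments do define a homomorphism.) The matrices act on column vectors from the left. Reducible means: after extending scalars to the fraction field $K=\mathbb{Q}(t)$, there is a $K$-subspace of $K^n$ (column vectors),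 different from $0$ and $K^n$, that is invariant under $\hat{\rho}_B(g)$ for all $g\in C_n$. *)

theory Defs
  imports
    "HOL-Algebra.Bij"
    "HOL-Library.Poly_Mapping"
    "HOL-Combinatorics.Permutations"
    "HOL-Computational_Algebra.Polynomial_Factorial"
    "Jordan_Normal_Form.VS_Connect"
begin

text \<open>
  Generators, matrix rows and matrix columns are all indexed by \<open>{..<n}\<close> instead of
  \<open>{1..n}\<close>, in agreement with the matrix library.
\<close>

section \<open>The free group of rank n\<close>

text \<open>The letter \<open>(i, True)\<close> stands for \<open>x_i\<close>, and \<open>(i, False)\<close> for its inverse.\<close>

type_synonym letter = "nat \<times> bool"

definition inv_letter :: "letter \<Rightarrow> letter" where
  "inv_letter a = (fst a, \<not> snd a)"

definition reduced :: "letter list \<Rightarrow> bool" where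
  "reduced w \<longleftrightarrow> successively (\<lambda>a b. b \<noteq> inv_letter a) w"

fun cons_red :: "letter \<Rightarrow> letter list \<Rightarrow> letter list" where
  "cons_red a [] = [a]"
| "cons_red a (b # w) = (if b = inv_letter a then w else a # b # w)"

definition free_group :: "nat \<Rightarrow> letter list monoid" where
  "free_group n =
    \<lparr>carrier = {w. reduced w \<and> fst ` set w \<subseteq> {..<n}},
     mult = \<lambda>u v. foldr cons_red u v,
     one = []\<rparr>"

definition gen :: "nat \<Rightarrow> letter list" where
  "gen i = [(i, True)]"

text \<open>The endomorphism of the free group that sends \<open>gen i\<close> to \<open>f i\<close>.\<close>

definition free_lift :: "nat \<Rightarrow> (nat \<Rightarrow> letter list) \<Rightarrow> letter list \<Rightarrow> letter list" where
  "free_lift n f = (\<lambda>w\<in>carrier (free_group n).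
     foldr (\<lambda>a u. (if snd a then f (fst a) else inv\<^bsub>free_group n\<^esub> f (fst a))
                    \<otimes>\<^bsub>free_group n\<^esub> u) w \<one>\<^bsub>free_group n\<^esub>)"

section \<open>Conjugating automorphisms\<close>

definition conj_auto :: "nat \<Rightarrow> (letter list \<Rightarrow> letter list) set" where
  "conj_auto n = {\<phi> \<in> auto (free_group n). \<exists>\<pi> f. \<pi> permutes {..<n} \<and>
     (\<forall>i<n. f i \<in> carrier (free_group n) \<and>
        \<phi> (gen i) = inv\<^bsub>free_group n\<^esub> f i \<otimes>\<^bsub>free_group n\<^esub> gen (\<pi> i) \<otimes>\<^bsub>free_group n\<^esub> f i)}"

text \<open>
  Automorphisms act from the right: the product of \<open>\<phi>\<close> and \<open>\<psi>\<close> is \<open>\<phi>\<close> followed by \<open>\<psi>\<close>.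
  This is the opposite of the multiplication of \<^const>\<open>AutoGroup\<close>.
\<close>

definition conj_group :: "nat \<Rightarrow> (letter list \<Rightarrow> letter list) monoid" where
  "conj_group n =
    \<lparr>carrier = conj_auto n,
     mult = \<lambda>\<phi> \<psi>. compose (carrier (free_group n)) \<psi> \<phi>,
     one = \<lambda>w\<in>carrier (free_group n). w\<rparr>"

definition eps :: "nat \<Rightarrow> nat \<Rightarrow> nat \<Rightarrow> letter list \<Rightarrow> letter list" where
  "eps n i j = free_lift n (\<lambda>l.
     if l = i then inv\<^bsub>free_group n\<^esub> gen j \<otimes>\<^bsub>free_group n\<^esub> gen i \<otimes>\<^bsub>free_group n\<^esub> gen j
     else gen l)"

definition alpha :: "nat \<Rightarrow> nat \<Rightarrow> letter list \<Rightarrow> letter list" where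
  "alpha n i = free_lift n (\<lambda>l. gen (transpose i (Suc i) l))"

section \<open>Laurent polynomials and the representation\<close>

text \<open>
  Finitely supported functions \<open>\<int> \<Rightarrow> \<int>\<close> with the convolution product are the group ring of
  \<open>\<int>\<close> over \<open>\<int>\<close>, which is the ring of integral Laurent polynomials in \<open>t\<close>; its fraction field
  is \<open>\<rat>(t)\<close>.
\<close>

type_synonym laurent = "int \<Rightarrow>\<^sub>0 int"

definition tpow :: "int \<Rightarrow> laurent" where
  "tpow k = Poly_Mapping.single k 1"

definition GL_laurent :: "nat \<Rightarrow> laurent mat monoid" where
  "GL_laurent n = units_of (ring_mat TYPE(laurent) n ())"

definition eps_mat :: "nat \<Rightarrow> nat \<Rightarrow> nat \<Rightarrow> laurent mat" where
  "eps_mat n i j = mat n n (\<lambda>(r, c).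
     if r = i then (if c = i then tpow (-1) else if c = j then 1 - tpow (-1) else 0)
     else (if r = c then 1 else 0))"

definition alpha_mat :: "nat \<Rightarrow> nat \<Rightarrow> laurent mat" where
  "alpha_mat n i = mat n n (\<lambda>(r, c). if c = transpose i (Suc i) r then 1 else 0)"

text \<open>
  The homomorphism with the prescribed values on the generators.  It is determined on
  \<^term>\<open>carrier (conj_group n)\<close> because these elements generate the group; its existence is shown
  in \<open>burau_bardakov_exists\<close> below.
\<close>

definition burau_bardakov :: "nat \<Rightarrow> ((letter list \<Rightarrow> letter list) \<Rightarrow> laurent mat) \<Rightarrow> bool" where
  "burau_bardakov n \<rho> \<longleftrightarrow>
     \<rho> \<in> hom (conj_group n) (GL_laurent n) \<and>
     (\<forall>i<n. \<forall>j<n. i \<noteq> j \<longrightarrow> \<rho> (eps n i j) = eps_mat n i j) \<and>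
     (\<forall>i. Suc i < n \<longrightarrow> \<rho> (alpha n i) = alpha_mat n i)"

definition reducible_rep :: "nat \<Rightarrow> ('g, 'b) monoid_scheme \<Rightarrow> ('g \<Rightarrow> laurent mat) \<Rightarrow> bool" where
  "reducible_rep n G \<rho> \<longleftrightarrow>
     (\<exists>W. VectorSpace.subspace (class_ring :: laurent fract ring) W (module_vec TYPE(laurent fract) n) \<and>
        W \<noteq> {0\<^sub>v n} \<and> W \<noteq> carrier_vec n \<and>
        (\<forall>g\<in>carrier G. \<forall>w\<in>W. map_mat to_fract (\<rho> g) *\<^sub>v w \<in> W))"

section \<open>The group structures\<close>

lemma inv_letter_simps [simp]:
  "inv_letter (inv_letter a) = a" "fst (inv_letter a) = fst a" "snd (inv_letter a) = (\<not> snd a)"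
  "inv_letter a \<noteq> a" "a \<noteq> inv_letter a" "inv_letter a = inv_letter b \<longleftrightarrow> a = b"
  by (auto simp: inv_letter_def prod_eq_iff)

lemma reduced_Cons: "reduced (a # w) \<longleftrightarrow> reduced w \<and> (w = [] \<or> hd w \<noteq> inv_letter a)"
  by (cases w) (auto simp: reduced_def)

lemma reduced_simps [simp]: "reduced []" "reduced [a]"
  by (auto simp: reduced_def)

lemma cons_red_reduced: "reduced (a # w) \<Longrightarrow> cons_red a w = a # w"
  by (cases w) (auto simp: reduced_Cons)

lemma reduced_cons_red: "reduced w \<Longrightarrow> reduced (cons_red a w)"
  by (cases w) (auto simp: reduced_Cons)

lemma fst_set_cons_red: "fst ` set (cons_red a w) \<subseteq> insert (fst a) (fst ` set w)"
  by (cases w) auto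

lemma cons_red_inverse: "reduced w \<Longrightarrow> cons_red a (cons_red (inv_letter a) w) = w"
  by (cases w) (auto simp: cons_red_reduced)

lemma reduced_foldr: "reduced v \<Longrightarrow> reduced (foldr cons_red u v)"
  by (induction u) (auto intro: reduced_cons_red)

lemma fst_set_foldr: "fst ` set (foldr cons_red u v) \<subseteq> fst ` set u \<union> fst ` set v"
proof (induction u)
  case (Cons a u)
  have "fst ` set (foldr cons_red (a # u) v) \<subseteq> insert (fst a) (fst ` set (foldr cons_red u v))"
    using fst_set_cons_red[of a "foldr cons_red u v"] by simp
  also have "\<dots> \<subseteq> insert (fst a) (fst ` set u \<union> fst ` set v)" using Cons.IH by blast
  finally show ?case by simp
qed auto

lemma foldr_cons_red_cons_red:
  assumes "reduced w"
  shows "foldr cons_red (cons_red a u) w = cons_red a (foldr cons_red u w)"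
proof (cases u)
  case (Cons b v)
  then show ?thesis
    using cons_red_inverse[OF reduced_foldr[OF assms, of v], of a] by auto
qed auto

lemma foldr_cons_red_assoc:
  "reduced w \<Longrightarrow> foldr cons_red (foldr cons_red u v) w = foldr cons_red u (foldr cons_red v w)"
  by (induction u) (auto simp: foldr_cons_red_cons_red)

lemma foldr_cons_red_Nil: "reduced u \<Longrightarrow> foldr cons_red u [] = u"
  by (induction u) (auto simp: reduced_Cons cons_red_reduced)

lemma foldr_cons_red_inverse:
  "reduced w \<Longrightarrow> foldr cons_red (rev (map inv_letter u)) (foldr cons_red u w) = w"
proof (induction u)
  case (Cons a u)
  have "reduced (foldr cons_red u w)" using Cons.prems by (rule reduced_foldr)
  from cons_red_inverse[OF this, of "inv_letter a"] show ?case using Cons by simp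
qed auto

lemma group_free_group: "group (free_group n)"
proof (rule groupI)
  fix u assume u: "u \<in> carrier (free_group n)"
  let ?v = "foldr cons_red (rev (map inv_letter u)) []"
  have "fst ` set (rev (map inv_letter u)) \<subseteq> {..<n}"
    using u by (auto simp: free_group_def image_image)
  then have "fst ` set ?v \<subseteq> {..<n}"
    using fst_set_foldr[of "rev (map inv_letter u)" "[]"] by (simp only: list.set image_empty Un_empty_right)
  then have v: "?v \<in> carrier (free_group n)"
    unfolding free_group_def by (simp add: reduced_foldr)
  have "foldr cons_red ?v u = foldr cons_red (rev (map inv_letter u)) (foldr cons_red u [])"
    using u by (subst foldr_cons_red_assoc) (auto simp: free_group_def foldr_cons_red_Nil)
  also have "\<dots> = []" by (rule foldr_cons_red_inverse) simp
  finally show "\<exists>v\<in>carrier (free_group n). v \<otimes>\<^bsub>free_group n\<^esub> u = \<one>\<^bsub>free_group n\<^esub>"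
    using v by (auto simp: free_group_def)
next
  fix u v assume "u \<in> carrier (free_group n)" "v \<in> carrier (free_group n)"
  then have "reduced (foldr cons_red u v)" "fst ` set (foldr cons_red u v) \<subseteq> {..<n}"
    by (auto simp only: free_group_def partial_object.select_convs mem_Collect_eq Un_subset_iff
        intro!: reduced_foldr order_trans[OF fst_set_foldr[of u v]])
  then show "u \<otimes>\<^bsub>free_group n\<^esub> v \<in> carrier (free_group n)"
    by (simp add: free_group_def)
qed (auto simp: free_group_def foldr_cons_red_assoc)

lemma gen_carrier: "i < n \<Longrightarrow> gen i \<in> carrier (free_group n)"
  by (auto simp: gen_def free_group_def)

lemma inv_gen: "i < n \<Longrightarrow> inv\<^bsub>free_group n\<^esub> gen i = [(i, False)]"
proof -
  assume i: "i < n"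
  interpret group "free_group n" by (rule group_free_group)
  show ?thesis
    by (rule inv_equality) (use i in \<open>auto simp: gen_def free_group_def inv_letter_def\<close>)
qed

definition hom_letter where
  "hom_letter G f a = (if snd a then f (fst a) else inv\<^bsub>G\<^esub> f (fst a))"

definition word_eval where
  "word_eval G f w = foldr (\<lambda>a u. hom_letter G f a \<otimes>\<^bsub>G\<^esub> u) w \<one>\<^bsub>G\<^esub>"

lemma word_eval_simps [simp]:
  "word_eval G f [] = \<one>\<^bsub>G\<^esub>" "word_eval G f (a # w) = hom_letter G f a \<otimes>\<^bsub>G\<^esub> word_eval G f w"
  by (auto simp: word_eval_def)

lemma word_eval_cong:
  assumes "\<And>i. i < n \<Longrightarrow> f i = g i" "w \<in> carrier (free_group n)"
  shows "word_eval G f w = word_eval G g w"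
  using assms(2) unfolding word_eval_def
  by (intro foldr_cong refl) (auto simp: assms(1) hom_letter_def free_group_def)

lemma free_lift_eq: "w \<in> carrier (free_group n) \<Longrightarrow> free_lift n f w = word_eval (free_group n) f w"
  by (simp add: free_lift_def word_eval_def hom_letter_def)

context group
begin

lemma hom_letter_closed:
  "\<lbrakk>\<And>i. i < n \<Longrightarrow> f i \<in> carrier G; fst a < n\<rbrakk> \<Longrightarrow> hom_letter G f a \<in> carrier G"
  by (auto simp: hom_letter_def)

lemma word_eval_closed:
  assumes "\<And>i. i < n \<Longrightarrow> f i \<in> carrier G"
  shows "fst ` set w \<subseteq> {..<n} \<Longrightarrow> word_eval G f w \<in> carrier G"
  by (induction w) (auto intro!: hom_letter_closed assms)

lemma word_eval_cons_red:
  assumes f: "\<And>i. i < n \<Longrightarrow> f i \<in> carrier G" and "fst a < n" "fst ` set w \<subseteq> {..<n}"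
  shows "word_eval G f (cons_red a w) = hom_letter G f a \<otimes> word_eval G f w"
proof (cases w)
  case (Cons b v)
  have v: "word_eval G f v \<in> carrier G" using assms Cons by (intro word_eval_closed[OF f]) auto
  have "hom_letter G f a \<otimes> (hom_letter G f (inv_letter a) \<otimes> word_eval G f v) = word_eval G f v"
    using v f[OF \<open>fst a < n\<close>] by (auto simp: hom_letter_def m_assoc[symmetric])
  then show ?thesis using Cons by auto
qed auto

lemma word_eval_hom:
  assumes f: "\<And>i. i < n \<Longrightarrow> f i \<in> carrier G"
  shows "word_eval G f \<in> hom (free_group n) G"
proof (rule homI)
  fix u v assume u: "u \<in> carrier (free_group n)" and v: "v \<in> carrier (free_group n)"
  have "fst ` set u \<subseteq> {..<n} \<Longrightarrow>
    word_eval G f (foldr cons_red u v) = word_eval G f u \<otimes> word_eval G f v"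
  proof (induction u)
    case Nil
    have "word_eval G f v \<in> carrier G"
      using v by (intro word_eval_closed[OF f]) (auto simp: free_group_def)
    then show ?case by simp
  next
    case (Cons a u)
    have "fst ` set (foldr cons_red u v) \<subseteq> {..<n}"
      using Cons.prems v by (intro order_trans[OF fst_set_foldr[of u v]]) (auto simp: free_group_def)
    then have "word_eval G f (foldr cons_red (a # u) v) =
        hom_letter G f a \<otimes> (word_eval G f u \<otimes> word_eval G f v)"
      using Cons by (auto simp: word_eval_cons_red[OF f])
    also have "\<dots> = word_eval G f (a # u) \<otimes> word_eval G f v"
      using Cons.prems v by (auto simp: free_group_def intro!: m_assoc[symmetric]
          hom_letter_closed[OF f] word_eval_closed[OF f])
    finally show ?case .
  qed
  then show "word_eval G f (u \<otimes>\<^bsub>free_group n\<^esub> v) = word_eval G f u \<otimes> word_eval G f v"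
    using u by (simp add: free_group_def)
qed (auto simp: free_group_def intro!: word_eval_closed[OF f])

lemma free_hom_unique:
  assumes h: "h \<in> hom (free_group n) G" and "w \<in> carrier (free_group n)"
  shows "h w = word_eval G (h \<circ> gen) w"
proof -
  interpret F: group "free_group n" by (rule group_free_group)
  interpret h: group_hom "free_group n" G h
    using h by (simp add: group_hom_def group_hom_axioms_def is_group group_free_group)
  from assms(2) show ?thesis
  proof (induction w)
    case Nil
    then show ?case using h.hom_one by (simp add: free_group_def)
  next
    case (Cons a w)
    have a: "fst a < n" and w: "w \<in> carrier (free_group n)" and red: "reduced (a # w)"
      using Cons.prems by (auto simp: free_group_def reduced_Cons)
    have s: "[a] \<in> carrier (free_group n)" using a by (auto simp: free_group_def)
    have "h (a # w) = h ([a] \<otimes>\<^bsub>free_group n\<^esub> w)"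
      using cons_red_reduced[OF red] by (simp add: free_group_def)
    also have "\<dots> = h [a] \<otimes> h w" using s w by simp
    also have "h [a] = hom_letter G (h \<circ> gen) a"
    proof (cases "snd a")
      case True
      then show ?thesis by (cases a) (auto simp: hom_letter_def gen_def)
    next
      case False
      then have "[a] = inv\<^bsub>free_group n\<^esub> gen (fst a)" using inv_gen[OF a] by (cases a) auto
      then have "h [a] = inv h (gen (fst a))" using gen_carrier[OF a] by simp
      then show ?thesis using False by (auto simp: hom_letter_def)
    qed
    finally show ?case using Cons.IH[OF w] by (simp only: word_eval_simps)
  qed
qed

end

lemma free_lift_hom:
  assumes "\<And>i. i < n \<Longrightarrow> f i \<in> carrier (free_group n)"
  shows "free_lift n f \<in> hom (free_group n) (free_group n)"
proof -
  interpret group "free_group n" by (rule group_free_group)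
  have "word_eval (free_group n) f \<in> hom (free_group n) (free_group n)"
    using assms by (rule word_eval_hom)
  then show ?thesis by (auto simp: hom_def free_lift_eq Pi_def)
qed

lemma free_lift_gen:
  assumes "i < n" "f i \<in> carrier (free_group n)"
  shows "free_lift n f (gen i) = f i"
proof -
  interpret group "free_group n" by (rule group_free_group)
  show ?thesis using assms by (simp add: free_lift_eq gen_carrier) (simp add: gen_def hom_letter_def)
qed

lemma free_end_eq:
  assumes "g \<in> hom (free_group n) (free_group n)" "h \<in> hom (free_group n) (free_group n)"
    and eq: "\<And>i. i < n \<Longrightarrow> g (gen i) = h (gen i)" and w: "w \<in> carrier (free_group n)"
  shows "g w = h w"
proof -
  interpret group "free_group n" by (rule group_free_group)
  have "word_eval (free_group n) (g \<circ> gen) w = word_eval (free_group n) (h \<circ> gen) w"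
    using w by (intro word_eval_cong) (auto simp: eq)
  then show ?thesis using assms free_hom_unique by metis
qed

lemma free_lift_auto:
  assumes f: "\<And>i. i < n \<Longrightarrow> f i \<in> carrier (free_group n)"
    and g: "\<And>i. i < n \<Longrightarrow> g i \<in> carrier (free_group n)"
    and fg: "\<And>i. i < n \<Longrightarrow> free_lift n f (g i) = gen i"
    and gf: "\<And>i. i < n \<Longrightarrow> free_lift n g (f i) = gen i"
  shows "free_lift n f \<in> auto (free_group n)"
proof -
  interpret group "free_group n" by (rule group_free_group)
  let ?C = "carrier (free_group n)"
  note hf = free_lift_hom[of n f, OF f] and hg = free_lift_hom[of n g, OF g]
  have id: "(\<lambda>w. w) \<in> hom (free_group n) (free_group n)" by (auto simp: hom_def)
  have *: "(\<lambda>w. free_lift n f (free_lift n g w)) \<in> hom (free_group n) (free_group n)"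
    "(\<lambda>w. free_lift n g (free_lift n f w)) \<in> hom (free_group n) (free_group n)"
    using hf hg by (auto simp: hom_def Pi_def)
  have 1: "free_lift n f (free_lift n g w) = w" if "w \<in> ?C" for w
    by (rule free_end_eq[OF *(1) id _ that]) (use g fg in \<open>simp add: free_lift_gen\<close>)
  have 2: "free_lift n g (free_lift n f w) = w" if "w \<in> ?C" for w
    by (rule free_end_eq[OF *(2) id _ that]) (use f gf in \<open>simp add: free_lift_gen\<close>)
  have "bij_betw (free_lift n f) ?C ?C"
    using hf hg 1 2 by (intro bij_betw_byWitness[where f' = "free_lift n g"]) (auto simp: hom_def)
  moreover have "free_lift n f \<in> extensional ?C" by (simp add: free_lift_def)
  ultimately show ?thesis using hf by (simp add: auto_def Bij_def)
qed

lemma autoD: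
  assumes "\<phi> \<in> auto G"
  shows "\<phi> \<in> hom G G" "bij_betw \<phi> (carrier G) (carrier G)" "\<phi> \<in> extensional (carrier G)"
  using assms by (auto simp: auto_def Bij_def)

lemma conj_autoI:
  assumes "\<phi> \<in> auto (free_group n)" "\<pi> permutes {..<n}"
    "\<And>i. i < n \<Longrightarrow> f i \<in> carrier (free_group n) \<and>
      \<phi> (gen i) = inv\<^bsub>free_group n\<^esub> f i \<otimes>\<^bsub>free_group n\<^esub> gen (\<pi> i) \<otimes>\<^bsub>free_group n\<^esub> f i"
  shows "\<phi> \<in> conj_auto n"
  unfolding conj_auto_def using assms by (intro CollectI conjI exI[of _ \<pi>] exI[of _ f]) simp_all

lemma conj_autoE:
  assumes "\<phi> \<in> conj_auto n"
  obtains \<pi> f where "\<phi> \<in> auto (free_group n)" "\<pi> permutes {..<n}"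
    "\<And>i. i < n \<Longrightarrow> f i \<in> carrier (free_group n)"
    "\<And>i. i < n \<Longrightarrow>
      \<phi> (gen i) = inv\<^bsub>free_group n\<^esub> f i \<otimes>\<^bsub>free_group n\<^esub> gen (\<pi> i) \<otimes>\<^bsub>free_group n\<^esub> f i"
  using assms unfolding conj_auto_def mem_Collect_eq by (elim conjE exE) (rule that, simp_all)

lemma eps_conj_auto:
  assumes i: "i < n" and j: "j < n" and ij: "i \<noteq> j"
  shows "eps n i j \<in> conj_auto n"
proof -
  interpret group "free_group n" by (rule group_free_group)
  note gc = gen_carrier[OF i] gen_carrier[OF j]
  define f where "f l = (if l = i then inv\<^bsub>free_group n\<^esub> gen j \<otimes>\<^bsub>free_group n\<^esub> gen i
     \<otimes>\<^bsub>free_group n\<^esub> gen j else gen l)" for l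
  define g where "g l = (if l = i then gen j \<otimes>\<^bsub>free_group n\<^esub> gen i
     \<otimes>\<^bsub>free_group n\<^esub> inv\<^bsub>free_group n\<^esub> gen j else gen l)" for l
  have f: "f l \<in> carrier (free_group n)" if "l < n" for l
    using that gc by (auto simp: f_def gen_carrier)
  have g: "g l \<in> carrier (free_group n)" if "l < n" for l
    using that gc by (auto simp: g_def gen_carrier)
  interpret ff: group_hom "free_group n" "free_group n" "free_lift n f"
    using free_lift_hom[of n f, OF f] by unfold_locales auto
  interpret gg: group_hom "free_group n" "free_group n" "free_lift n g"
    using free_lift_hom[of n g, OF g] by unfold_locales auto
  have fi: "free_lift n f (gen i) = f i" "free_lift n f (gen j) = gen j"
    "free_lift n g (gen i) = g i" "free_lift n g (gen j) = gen j"
    using i j f g ij by (simp_all add: free_lift_gen) (simp_all add: f_def g_def)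
  have "free_lift n f (g i) = gen i"
    using gc f[OF i] by (simp add: g_def fi) (simp add: f_def m_assoc[symmetric], simp add: m_assoc)
  moreover have "free_lift n g (f i) = gen i"
    using gc g[OF i] by (simp add: f_def fi) (simp add: g_def m_assoc[symmetric], simp add: m_assoc)
  moreover have "free_lift n f (g l) = gen l" "free_lift n g (f l) = gen l" if "l < n" "l \<noteq> i" for l
    using that f[of l] g[of l] by (simp_all add: f_def g_def free_lift_gen)
  ultimately have "free_lift n f (g l) = gen l" "free_lift n g (f l) = gen l" if "l < n" for l
    using that by (cases "l = i"; simp)+
  then have a: "free_lift n f \<in> auto (free_group n)"
    using f g by (intro free_lift_auto[of n f g])
  have e: "eps n i j = free_lift n f" by (simp add: eps_def f_def[abs_def])
  let ?c = "\<lambda>l. if l = i then gen j else \<one>\<^bsub>free_group n\<^esub>"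
  have "?c l \<in> carrier (free_group n) \<and>
      eps n i j (gen l) = inv\<^bsub>free_group n\<^esub> ?c l \<otimes>\<^bsub>free_group n\<^esub> gen (id l) \<otimes>\<^bsub>free_group n\<^esub> ?c l"
    if "l < n" for l
    using that f[OF that] gc gen_carrier[OF that] by (simp add: e free_lift_gen) (simp add: f_def)
  then show ?thesis by (rule conj_autoI[OF a[folded e] permutes_id])
qed

lemma alpha_conj_auto:
  assumes i: "Suc i < n"
  shows "alpha n i \<in> conj_auto n"
proof -
  interpret group "free_group n" by (rule group_free_group)
  let ?t = "transpose i (Suc i)"
  have t: "?t l < n" if "l < n" for l using that i by (auto simp: transpose_def)
  have a: "alpha n i \<in> auto (free_group n)"
    unfolding alpha_def using t
    by (intro free_lift_auto[where g = "\<lambda>l. gen (?t l)"]) (auto simp: gen_carrier free_lift_gen)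
  have "\<one>\<^bsub>free_group n\<^esub> \<in> carrier (free_group n) \<and> alpha n i (gen l) =
      inv\<^bsub>free_group n\<^esub> \<one>\<^bsub>free_group n\<^esub> \<otimes>\<^bsub>free_group n\<^esub> gen (?t l) \<otimes>\<^bsub>free_group n\<^esub> \<one>\<^bsub>free_group n\<^esub>"
    if "l < n" for l
    using that t[OF that] by (simp add: alpha_def free_lift_gen gen_carrier)
  moreover have "?t permutes {..<n}" using i by (intro permutes_swap_id) auto
  ultimately show ?thesis
    by (intro conj_autoI[OF a, of ?t "\<lambda>_. \<one>\<^bsub>free_group n\<^esub>"]) blast+
qed

lemma group_conj_group: "group (conj_group n)"
proof (rule groupI)
  interpret group "free_group n" by (rule group_free_group)
  let ?C = "carrier (free_group n)"
  {
    fix \<phi> \<psi> assume "\<phi> \<in> carrier (conj_group n)" "\<psi> \<in> carrier (conj_group n)"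
    then have p: "\<phi> \<in> conj_auto n" and q: "\<psi> \<in> conj_auto n" by (auto simp: conj_group_def)
    from p obtain \<pi> f where \<phi>: "\<phi> \<in> auto (free_group n)" "\<pi> permutes {..<n}"
      and f: "\<And>i. i < n \<Longrightarrow> f i \<in> ?C"
        "\<And>i. i < n \<Longrightarrow> \<phi> (gen i) = inv\<^bsub>free_group n\<^esub> f i \<otimes>\<^bsub>free_group n\<^esub> gen (\<pi> i) \<otimes>\<^bsub>free_group n\<^esub> f i"
      by (rule conj_autoE) blast
    from q obtain \<sigma> g where \<psi>: "\<psi> \<in> auto (free_group n)" "\<sigma> permutes {..<n}"
      and g: "\<And>i. i < n \<Longrightarrow> g i \<in> ?C"
        "\<And>i. i < n \<Longrightarrow> \<psi> (gen i) = inv\<^bsub>free_group n\<^esub> g i \<otimes>\<^bsub>free_group n\<^esub> gen (\<sigma> i) \<otimes>\<^bsub>free_group n\<^esub> g i"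
      by (rule conj_autoE) blast
    interpret psi: group_hom "free_group n" "free_group n" \<psi>
      using autoD(1)[OF \<psi>(1)] by unfold_locales auto
    have \<pi>: "\<pi> i < n" if "i < n" for i using permutes_in_image[OF \<phi>(2)] that by auto
    have \<sigma>: "\<sigma> i < n" if "i < n" for i using permutes_in_image[OF \<psi>(2)] that by auto
    let ?h = "\<lambda>i. g (\<pi> i) \<otimes>\<^bsub>free_group n\<^esub> \<psi> (f i)"
    have "compose ?C \<psi> \<phi> \<in> auto (free_group n)"
      using autoD[OF \<phi>(1)] autoD[OF \<psi>(1)] by (auto simp: auto_def Bij_def hom_compose bij_betw_compose)
    moreover have "?h i \<in> ?C \<and> compose ?C \<psi> \<phi> (gen i) = inv\<^bsub>free_group n\<^esub> ?h i \<otimes>\<^bsub>free_group n\<^esub>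
         gen ((\<sigma> \<circ> \<pi>) i) \<otimes>\<^bsub>free_group n\<^esub> ?h i" if i: "i < n" for i
      using i f(1)[OF i] \<pi>[OF i] g(1)[OF \<pi>[OF i]] gen_carrier[OF \<sigma>[OF \<pi>[OF i]]]
      by (simp add: compose_def gen_carrier f(2) g(2) inv_mult_group m_assoc)
    moreover have "\<sigma> \<circ> \<pi> permutes {..<n}" using \<phi>(2) \<psi>(2) by (rule permutes_compose)
    ultimately have "compose ?C \<psi> \<phi> \<in> conj_auto n"
      by (intro conj_autoI[where \<pi> = "\<sigma> \<circ> \<pi>" and f = ?h])
    then show "\<phi> \<otimes>\<^bsub>conj_group n\<^esub> \<psi> \<in> carrier (conj_group n)"
      by (simp add: conj_group_def)
  }
  {
    have "(\<lambda>w\<in>?C. w) \<in> auto (free_group n)" by (rule id_in_auto)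
    moreover have "\<one>\<^bsub>free_group n\<^esub> \<in> ?C \<and> (\<lambda>w\<in>?C. w) (gen i) = inv\<^bsub>free_group n\<^esub> \<one>\<^bsub>free_group n\<^esub>
         \<otimes>\<^bsub>free_group n\<^esub> gen (id i) \<otimes>\<^bsub>free_group n\<^esub> \<one>\<^bsub>free_group n\<^esub>" if "i < n" for i
      using that by (simp add: gen_carrier)
    ultimately have "(\<lambda>w\<in>?C. w) \<in> conj_auto n"
      by (intro conj_autoI[where \<pi> = id and f = "\<lambda>_. \<one>\<^bsub>free_group n\<^esub>"] permutes_id)
    then show "\<one>\<^bsub>conj_group n\<^esub> \<in> carrier (conj_group n)"
      by (simp add: conj_group_def)
  }
  {
    fix \<phi> \<psi> \<chi> assume "\<phi> \<in> carrier (conj_group n)" "\<psi> \<in> carrier (conj_group n)"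
    then show "\<phi> \<otimes>\<^bsub>conj_group n\<^esub> \<psi> \<otimes>\<^bsub>conj_group n\<^esub> \<chi> = \<phi> \<otimes>\<^bsub>conj_group n\<^esub> (\<psi> \<otimes>\<^bsub>conj_group n\<^esub> \<chi>)"
      by (auto simp: conj_group_def conj_auto_def auto_def hom_def intro!: compose_assoc)
  }
  {
    fix \<phi> assume "\<phi> \<in> carrier (conj_group n)"
    then show "\<one>\<^bsub>conj_group n\<^esub> \<otimes>\<^bsub>conj_group n\<^esub> \<phi> = \<phi>"
      by (auto simp: conj_group_def conj_auto_def auto_def Bij_def intro!: compose_Id bij_betw_imp_funcset)
  }
  {
    fix \<phi> assume "\<phi> \<in> carrier (conj_group n)"
    then obtain \<pi> f where \<phi>: "\<phi> \<in> auto (free_group n)" "\<pi> permutes {..<n}"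
      and f: "\<And>i. i < n \<Longrightarrow> f i \<in> ?C"
        "\<And>i. i < n \<Longrightarrow> \<phi> (gen i) = inv\<^bsub>free_group n\<^esub> f i \<otimes>\<^bsub>free_group n\<^esub> gen (\<pi> i) \<otimes>\<^bsub>free_group n\<^esub> f i"
      unfolding conj_group_def partial_object.select_convs by (rule conj_autoE) blast
    define \<psi> where "\<psi> = restrict (inv_into ?C \<phi>) ?C"
    note b = autoD(2)[OF \<phi>(1)]
    have bp: "bij_betw \<psi> ?C ?C"
      using bij_betw_inv_into[OF b] by (simp add: \<psi>_def cong: bij_betw_cong)
    interpret phi: group_hom "free_group n" "free_group n" \<phi>
      using autoD(1)[OF \<phi>(1)] by unfold_locales auto
    have l: "\<psi> (\<phi> w) = w" if "w \<in> ?C" for w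
      using that b by (simp add: \<psi>_def bij_betw_inv_into_left)
    have r: "\<phi> (\<psi> w) = w" if "w \<in> ?C" for w
      using that b by (simp add: \<psi>_def bij_betw_inv_into_right)
    have c: "\<psi> w \<in> ?C" if "w \<in> ?C" for w using bp that by (auto simp: bij_betw_def)
    have hp: "\<psi> \<in> hom (free_group n) (free_group n)"
    proof (rule homI)
      fix u v assume uv: "u \<in> ?C" "v \<in> ?C"
      have "\<psi> (u \<otimes>\<^bsub>free_group n\<^esub> v) = \<psi> (\<phi> (\<psi> u \<otimes>\<^bsub>free_group n\<^esub> \<psi> v))"
        using uv c r by simp
      also have "\<dots> = \<psi> u \<otimes>\<^bsub>free_group n\<^esub> \<psi> v" using uv c by (intro l) simp
      finally show "\<psi> (u \<otimes>\<^bsub>free_group n\<^esub> v) = \<psi> u \<otimes>\<^bsub>free_group n\<^esub> \<psi> v" .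
    qed (rule c)
    interpret psi: group_hom "free_group n" "free_group n" \<psi>
      using hp by unfold_locales auto
    let ?\<sigma> = "inv_into UNIV \<pi>"
    have \<sigma>: "?\<sigma> permutes {..<n}" by (rule permutes_inv[OF \<phi>(2)])
    let ?h = "\<lambda>i. inv\<^bsub>free_group n\<^esub> \<psi> (f (?\<sigma> i))"
    have "?h i \<in> ?C \<and> \<psi> (gen i) = inv\<^bsub>free_group n\<^esub> ?h i \<otimes>\<^bsub>free_group n\<^esub> gen (?\<sigma> i) \<otimes>\<^bsub>free_group n\<^esub> ?h i"
      if i: "i < n" for i
    proof -
      have k: "?\<sigma> i < n" using permutes_in_image[OF \<sigma>] i by auto
      have "\<pi> (?\<sigma> i) = i" by (rule permutes_inverses(1)[OF \<phi>(2)])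
      then have "gen i = f (?\<sigma> i) \<otimes>\<^bsub>free_group n\<^esub> \<phi> (gen (?\<sigma> i)) \<otimes>\<^bsub>free_group n\<^esub> inv\<^bsub>free_group n\<^esub> f (?\<sigma> i)"
        using f(1)[OF k] gen_carrier[OF i] f(2)[OF k]
        by (simp add: m_assoc) (simp add: m_assoc[symmetric])
      then have "\<psi> (gen i) = \<psi> (f (?\<sigma> i)) \<otimes>\<^bsub>free_group n\<^esub> gen (?\<sigma> i) \<otimes>\<^bsub>free_group n\<^esub> inv\<^bsub>free_group n\<^esub> \<psi> (f (?\<sigma> i))"
        using f(1)[OF k] gen_carrier[OF k] by (simp add: l)
      then show ?thesis using f(1)[OF k] by simp
    qed
    moreover have "\<psi> \<in> auto (free_group n)"
      using hp bp by (auto simp: auto_def Bij_def \<psi>_def)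
    ultimately have "\<psi> \<in> conj_auto n" using \<sigma> by (intro conj_autoI[of \<psi> n ?\<sigma> ?h])
    moreover have "compose ?C \<phi> \<psi> = (\<lambda>w\<in>?C. w)" using r by (auto simp: compose_def)
    ultimately show "\<exists>\<psi>\<in>carrier (conj_group n). \<psi> \<otimes>\<^bsub>conj_group n\<^esub> \<phi> = \<one>\<^bsub>conj_group n\<^esub>"
      by (auto simp: conj_group_def)
  }
qed

section \<open>Existence of the representation\<close>

text \<open>
  The representation is the Jacobian of Fox derivatives with all generators specialised to \<open>t\<close>.
  A word is sent to its total degree and its row of specialised Fox derivatives; the product rule
  for the derivatives is the multiplication of \<open>fox_group\<close>.
\<close>


definition fox_group :: "(int \<times> (nat \<Rightarrow> laurent)) monoid" where
  "fox_group = \<lparr>carrier = UNIV,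
     mult = \<lambda>(d, u) (e, v). (d + e, \<lambda>c. u c + tpow d * v c), one = (0, \<lambda>_. 0)\<rparr>"

lemma tpow_add: "tpow (a + b) = tpow a * tpow b" by (simp add: tpow_def mult_single)
lemma tpow_0: "tpow 0 = 1" by (simp add: tpow_def)

lemma group_fox: "group fox_group"
proof (rule groupI)
  fix x assume "x \<in> carrier fox_group"
  show "\<exists>y\<in>carrier fox_group. y \<otimes>\<^bsub>fox_group\<^esub> x = \<one>\<^bsub>fox_group\<^esub>"
    by (rule bexI[of _ "(- fst x, \<lambda>c. - tpow (- fst x) * snd x c)"])
      (auto simp: fox_group_def split: prod.splits)
qed (auto simp: fox_group_def tpow_add tpow_0 algebra_simps)

definition fox :: "letter list \<Rightarrow> int \<times> (nat \<Rightarrow> laurent)" where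
  "fox = word_eval fox_group (\<lambda>i. (1, \<lambda>c. if c = i then 1 else 0))"

lemma fox_hom: "fox \<in> hom (free_group n) fox_group"
proof -
  interpret group fox_group by (rule group_fox)
  show ?thesis unfolding fox_def by (rule word_eval_hom) (auto simp: fox_group_def)
qed

lemma fox_gen: "fox (gen i) = (1, \<lambda>c. if c = i then 1 else 0)"
  by (auto simp: fox_def gen_def hom_letter_def fox_group_def)

lemma fox_mult:
  assumes "u \<in> carrier (free_group n)" "v \<in> carrier (free_group n)"
  shows "fox (u \<otimes>\<^bsub>free_group n\<^esub> v) = (fst (fox u) + fst (fox v),
      \<lambda>c. snd (fox u) c + tpow (fst (fox u)) * snd (fox v) c)"
  using hom_mult[OF fox_hom assms] by (auto simp: fox_group_def split: prod.splits)

lemma fox_inv: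
  assumes "u \<in> carrier (free_group n)"
  shows "fox (inv\<^bsub>free_group n\<^esub> u) = (- fst (fox u), \<lambda>c. - tpow (- fst (fox u)) * snd (fox u) c)"
proof -
  interpret group_hom "free_group n" fox_group fox
    by (simp add: group_hom_def group_hom_axioms_def group_free_group group_fox fox_hom)
  have "inv\<^bsub>fox_group\<^esub> (fox u) = (- fst (fox u), \<lambda>c. - tpow (- fst (fox u)) * snd (fox u) c)"
    by (rule H.inv_equality) (auto simp: fox_group_def split: prod.splits)
  then show ?thesis using assms by simp
qed

lemma fox_chain:
  assumes h: "h \<in> hom (free_group n) (free_group n)"
    and deg: "\<And>i. i < n \<Longrightarrow> fst (fox (h (gen i))) = 1"
    and w: "w \<in> carrier (free_group n)"
  shows "fox (h w) = (fst (fox w), \<lambda>c. \<Sum>k<n. snd (fox w) k * snd (fox (h (gen k))) c)"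
proof -
  interpret fox: group fox_group by (rule group_fox)
  let ?H = "\<lambda>w. (fst (fox w), \<lambda>c. \<Sum>k<n. snd (fox w) k * snd (fox (h (gen k))) c)"
  have 1: "(\<lambda>w. fox (h w)) \<in> hom (free_group n) fox_group"
    using h fox_hom[of n] by (auto simp: hom_def Pi_def)
  have 2: "?H \<in> hom (free_group n) fox_group"
    by (rule homI) (auto simp: fox_mult fox_group_def algebra_simps sum.distrib sum_distrib_left)
  have eq: "((\<lambda>w. fox (h w)) \<circ> gen) i = (?H \<circ> gen) i" if "i < n" for i
    using that deg[OF that] by (auto simp: fox_gen prod_eq_iff if_distrib[of "\<lambda>x. x * _"] cong: if_cong)
  have "word_eval fox_group ((\<lambda>w. fox (h w)) \<circ> gen) w = word_eval fox_group (?H \<circ> gen) w"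
    by (rule word_eval_cong[OF eq w])
  then show ?thesis using fox.free_hom_unique[OF 1 w] fox.free_hom_unique[OF 2 w] by simp
qed

lemma conj_auto_degree:
  assumes "\<phi> \<in> conj_auto n" "i < n"
  shows "fst (fox (\<phi> (gen i))) = 1"
proof -
  interpret group "free_group n" by (rule group_free_group)
  from assms(1) obtain \<pi> f where p: "\<pi> permutes {..<n}" and "\<And>i. i < n \<Longrightarrow> f i \<in> carrier (free_group n)"
    "\<And>i. i < n \<Longrightarrow> \<phi> (gen i) = inv\<^bsub>free_group n\<^esub> f i \<otimes>\<^bsub>free_group n\<^esub> gen (\<pi> i) \<otimes>\<^bsub>free_group n\<^esub> f i"
    by (rule conj_autoE) blast
  then have f: "f i \<in> carrier (free_group n)"
    "\<phi> (gen i) = inv\<^bsub>free_group n\<^esub> f i \<otimes>\<^bsub>free_group n\<^esub> gen (\<pi> i) \<otimes>\<^bsub>free_group n\<^esub> f i"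
    using assms(2) by auto
  have "\<pi> i < n" using permutes_in_image[OF p] assms(2) by auto
  then show ?thesis using f by (simp add: fox_mult fox_inv gen_carrier fox_gen)
qed

definition fox_jac :: "nat \<Rightarrow> (letter list \<Rightarrow> letter list) \<Rightarrow> laurent mat" where
  "fox_jac n \<phi> = mat n n (\<lambda>(r, c). snd (fox (\<phi> (gen r))) c)"

lemma burau_bardakov_exists: "burau_bardakov n (fox_jac n)"
proof -
  interpret F: group "free_group n" by (rule group_free_group)
  interpret C: group "conj_group n" by (rule group_conj_group)
  let ?R = "ring_mat TYPE(laurent) n ()"
  interpret R: ring ?R by (rule ring_mat)
  have mult: "fox_jac n (\<phi> \<otimes>\<^bsub>conj_group n\<^esub> \<psi>) = fox_jac n \<phi> \<otimes>\<^bsub>?R\<^esub> fox_jac n \<psi>"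
    if "\<phi> \<in> carrier (conj_group n)" "\<psi> \<in> carrier (conj_group n)" for \<phi> \<psi>
  proof -
    have c: "\<phi> \<in> conj_auto n" "\<psi> \<in> conj_auto n" using that by (auto simp: conj_group_def)
    then have h: "\<phi> \<in> hom (free_group n) (free_group n)" "\<psi> \<in> hom (free_group n) (free_group n)"
      by (auto simp: conj_auto_def auto_def)
    have g: "\<phi> (gen r) \<in> carrier (free_group n)" if "r < n" for r
      using h(1) gen_carrier[OF that] by (auto simp: hom_def)
    show ?thesis
      by (rule eq_matI)
        (auto simp: fox_jac_def ring_mat_def conj_group_def compose_def gen_carrier scalar_prod_def
          fox_chain[OF h(2) conj_auto_degree[OF c(2)] g] lessThan_atLeast0)
  qed
  have one: "fox_jac n \<one>\<^bsub>conj_group n\<^esub> = \<one>\<^bsub>?R\<^esub>"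
    by (rule eq_matI) (auto simp: fox_jac_def ring_mat_def conj_group_def gen_carrier fox_gen)
  have unit: "fox_jac n \<phi> \<in> Units ?R" if "\<phi> \<in> carrier (conj_group n)" for \<phi>
  proof -
    let ?i = "inv\<^bsub>conj_group n\<^esub> \<phi>"
    have "fox_jac n \<phi> \<otimes>\<^bsub>?R\<^esub> fox_jac n ?i = \<one>\<^bsub>?R\<^esub>" "fox_jac n ?i \<otimes>\<^bsub>?R\<^esub> fox_jac n \<phi> = \<one>\<^bsub>?R\<^esub>"
      using that mult[of \<phi> ?i] mult[of ?i \<phi>] one by simp_all
    moreover have "fox_jac n \<psi> \<in> carrier ?R" for \<psi> by (simp add: fox_jac_def ring_mat_def)
    ultimately show ?thesis unfolding Units_def by blast
  qed
  have "fox_jac n \<in> hom (conj_group n) (GL_laurent n)"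
    using mult unit by (auto simp: hom_def GL_laurent_def units_of_def)
  moreover have "fox_jac n (eps n i j) = eps_mat n i j" if "i < n" "j < n" "i \<noteq> j" for i j
  proof (rule eq_matI)
    fix r c assume "r < dim_row (eps_mat n i j)" "c < dim_col (eps_mat n i j)"
    then have r: "r < n" "c < n" by (auto simp: eps_mat_def)
    have "eps n i j (gen r) = (if r = i then inv\<^bsub>free_group n\<^esub> gen j \<otimes>\<^bsub>free_group n\<^esub> gen i
       \<otimes>\<^bsub>free_group n\<^esub> gen j else gen r)"
      unfolding eps_def using that r gen_carrier by (subst free_lift_gen) auto
    then show "fox_jac n (eps n i j) $$ (r, c) = eps_mat n i j $$ (r, c)"
      using that r by (auto simp: fox_jac_def eps_mat_def fox_mult fox_inv gen_carrier fox_gen tpow_0)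
  qed (auto simp: fox_jac_def eps_mat_def)
  moreover have "fox_jac n (alpha n i) = alpha_mat n i" if "Suc i < n" for i
  proof (rule eq_matI)
    fix r c assume "r < dim_row (alpha_mat n i)" "c < dim_col (alpha_mat n i)"
    then have r: "r < n" "c < n" by (auto simp: alpha_mat_def)
    have "transpose i (Suc i) r < n" using that r by (auto simp: transpose_def)
    then have "alpha n i (gen r) = gen (transpose i (Suc i) r)"
      unfolding alpha_def using r gen_carrier by (subst free_lift_gen) auto
    then show "fox_jac n (alpha n i) $$ (r, c) = alpha_mat n i $$ (r, c)"
      using r by (auto simp: fox_jac_def alpha_mat_def fox_gen)
  qed (auto simp: fox_jac_def alpha_mat_def)
  ultimately show ?thesis by (auto simp: burau_bardakov_def)
qed

end

theory Submission
  imports Defs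
begin

text \<open>
  All matrices \<open>eps_mat n i j\<close> and \<open>alpha_mat n i\<close> have row sums \<open>1\<close>, which suggests that the
  constant vectors are an invariant line.  The invariance under an arbitrary element of
  \<open>conj_group n\<close> follows from a description of this line by the normal subgroup of inner
  automorphisms.

  Conjugation by \<open>x_j\<close> is the product of the \<open>eps n i j\<close> over all \<open>i \<noteq> j\<close>.  Hence the image of
  every inner automorphism is known, and it fixes the vector of ones (\<open>burau_inner_ones\<close>).
  Moreover, a vector fixed by the image of a single conjugation by a generator is constant
  (\<open>inner_fixed_vec_const\<close>), because \<open>t \<noteq> 1\<close>.  So the constant vectors are exactly the common
  fixed vectors of the inner automorphisms.  These form a normal
  subgroup (\<open>inner_normal\<close>), and the fixed space of a normal subgroup is invariant under the whole
  group (\<open>burau_ones_eigenvector\<close>).  Over the fraction field the constant vectors are a line, which is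
  a proper nonzero subspace as soon as \<open>n \<ge> 2\<close>.
\<close>

section \<open>Inner automorphisms\<close>

definition inner :: "nat \<Rightarrow> letter list \<Rightarrow> letter list \<Rightarrow> letter list" where
  "inner n w = (\<lambda>x\<in>carrier (free_group n). inv\<^bsub>free_group n\<^esub> w \<otimes>\<^bsub>free_group n\<^esub> x \<otimes>\<^bsub>free_group n\<^esub> w)"

lemma inner_hom:
  assumes "w \<in> carrier (free_group n)"
  shows "inner n w \<in> hom (free_group n) (free_group n)"
proof -
  interpret group "free_group n" by (rule group_free_group)
  show ?thesis
  proof (rule homI)
    fix x y assume "x \<in> carrier (free_group n)" "y \<in> carrier (free_group n)"
    moreover from this assms have "w \<otimes>\<^bsub>free_group n\<^esub> (inv\<^bsub>free_group n\<^esub> w \<otimes>\<^bsub>free_group n\<^esub> (y \<otimes>\<^bsub>free_group n\<^esub> w)) = y \<otimes>\<^bsub>free_group n\<^esub> w"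
      by (simp add: m_assoc[symmetric])
    ultimately show "inner n w (x \<otimes>\<^bsub>free_group n\<^esub> y) = inner n w x \<otimes>\<^bsub>free_group n\<^esub> inner n w y"
      using assms by (simp add: inner_def m_assoc)
  qed (use assms in \<open>simp add: inner_def\<close>)
qed

lemma compose_inner:
  assumes u: "u \<in> carrier (free_group n)" and v: "v \<in> carrier (free_group n)"
  shows "compose (carrier (free_group n)) (inner n v) (inner n u) = inner n (u \<otimes>\<^bsub>free_group n\<^esub> v)"
proof -
  interpret group "free_group n" by (rule group_free_group)
  show ?thesis using u v
    by (intro ext) (auto simp: compose_def inner_def restrict_def inv_mult_group m_assoc)
qed

lemma inner_one: "inner n \<one>\<^bsub>free_group n\<^esub> = \<one>\<^bsub>conj_group n\<^esub>"
proof -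
  interpret group "free_group n" by (rule group_free_group)
  show ?thesis by (auto simp: inner_def conj_group_def)
qed

text \<open>
  Conjugation is taken as \<open>x \<mapsto> w\<inverse> x w\<close>, so that \<open>inner n\<close> is a homomorphism and not an
  antihomomorphism for the product of \<open>conj_group\<close>, in which the left factor acts first.
\<close>

lemma inner_mult:
  assumes "u \<in> carrier (free_group n)" "v \<in> carrier (free_group n)"
  shows "inner n u \<otimes>\<^bsub>conj_group n\<^esub> inner n v = inner n (u \<otimes>\<^bsub>free_group n\<^esub> v)"
  using compose_inner[OF assms] by (simp add: conj_group_def)

lemma inner_conj_group:
  assumes w: "w \<in> carrier (free_group n)"
  shows "inner n w \<in> carrier (conj_group n)"
proof -
  interpret group "free_group n" by (rule group_free_group)
  let ?C = "carrier (free_group n)" and ?v = "inv\<^bsub>free_group n\<^esub> w"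
  have v: "?v \<in> ?C" using w by simp
  have "inner n ?v (inner n w x) = x" "inner n w (inner n ?v x) = x" if "x \<in> ?C" for x
    using fun_cong[OF compose_inner[OF w v], of x] fun_cong[OF compose_inner[OF v w], of x] that w
    by (simp_all add: compose_def inner_one) (simp_all add: conj_group_def)
  then have "bij_betw (inner n w) ?C ?C"
    using inner_hom[OF w] inner_hom[OF v]
    by (intro bij_betw_byWitness[where f' = "inner n ?v"]) (auto simp: hom_def)
  moreover have "inner n w \<in> extensional ?C" by (simp add: inner_def)
  ultimately have "inner n w \<in> auto (free_group n)"
    using inner_hom[OF w] by (simp add: auto_def Bij_def)
  then have "inner n w \<in> conj_auto n"
    by (rule conj_autoI[OF _ permutes_id, where f = "\<lambda>_. w"]) (use w in \<open>simp add: inner_def gen_carrier\<close>)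
  then show ?thesis by (simp add: conj_group_def)
qed

text \<open>
  Both sides are the map \<open>x \<mapsto> \<phi>(w)\<inverse> \<phi>(x) \<phi>(w)\<close>.  This is the form of normality that moves an
  inner automorphism past \<open>\<phi>\<close> without the inverse of \<open>\<phi>\<close>.
\<close>

lemma inner_normal:
  assumes \<phi>: "\<phi> \<in> carrier (conj_group n)" and w: "w \<in> carrier (free_group n)"
  shows "inner n w \<otimes>\<^bsub>conj_group n\<^esub> \<phi> = \<phi> \<otimes>\<^bsub>conj_group n\<^esub> inner n (\<phi> w)"
proof -
  interpret group "free_group n" by (rule group_free_group)
  interpret group_hom "free_group n" "free_group n" \<phi>
    using \<phi> by unfold_locales (auto simp: conj_group_def conj_auto_def auto_def)
  show ?thesis using w
    by (intro ext) (auto simp: conj_group_def compose_def inner_def restrict_def)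
qed

section \<open>Conjugating some of the generators by a fixed one\<close>

text \<open>
  These automorphisms interpolate between the identity (\<open>S\<close> empty), \<open>eps n i j\<close> (\<open>S = {i}\<close>) and
  conjugation by \<open>x_j\<close> (\<open>S\<close> consists of all indices other than \<open>j\<close>).
\<close>

definition part_conj :: "nat \<Rightarrow> nat set \<Rightarrow> nat \<Rightarrow> letter list \<Rightarrow> letter list" where
  "part_conj n S j = free_lift n (\<lambda>l.
     if l \<in> S then inv\<^bsub>free_group n\<^esub> gen j \<otimes>\<^bsub>free_group n\<^esub> gen l \<otimes>\<^bsub>free_group n\<^esub> gen j else gen l)"

lemma part_conj_hom:
  assumes "j < n"
  shows "part_conj n S j \<in> hom (free_group n) (free_group n)"
proof -
  interpret group "free_group n" by (rule group_free_group)
  show ?thesis unfolding part_conj_def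
    by (rule free_lift_hom) (use assms in \<open>simp add: gen_carrier\<close>)
qed

lemma part_conj_gen:
  assumes "j < n" "l < n"
  shows "part_conj n S j (gen l) =
    (if l \<in> S then inv\<^bsub>free_group n\<^esub> gen j \<otimes>\<^bsub>free_group n\<^esub> gen l \<otimes>\<^bsub>free_group n\<^esub> gen j else gen l)"
proof -
  interpret group "free_group n" by (rule group_free_group)
  show ?thesis unfolding part_conj_def
    by (rule free_lift_gen) (use assms in \<open>simp_all add: gen_carrier\<close>)
qed

lemma part_conj_extensional: "part_conj n S j \<in> extensional (carrier (free_group n))"
  by (simp add: part_conj_def free_lift_def)

lemma part_conj_eqI:
  assumes "j < n" and "h \<in> hom (free_group n) (free_group n)" "h \<in> extensional (carrier (free_group n))"
    and "\<And>l. l < n \<Longrightarrow> h (gen l) =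
      (if l \<in> S then inv\<^bsub>free_group n\<^esub> gen j \<otimes>\<^bsub>free_group n\<^esub> gen l \<otimes>\<^bsub>free_group n\<^esub> gen j else gen l)"
  shows "h = part_conj n S j"
proof (rule extensionalityI[OF assms(3) part_conj_extensional])
  fix x assume "x \<in> carrier (free_group n)"
  then show "h x = part_conj n S j x"
    by (rule free_end_eq[OF assms(2) part_conj_hom[OF assms(1)], rotated])
      (simp add: assms(1,4) part_conj_gen)
qed

lemma part_conj_empty:
  assumes "j < n"
  shows "part_conj n {} j = \<one>\<^bsub>conj_group n\<^esub>"
proof (rule part_conj_eqI[symmetric, OF assms])
  interpret group "free_group n" by (rule group_free_group)
  show "\<one>\<^bsub>conj_group n\<^esub> \<in> hom (free_group n) (free_group n)"
    by (rule homI) (simp_all add: conj_group_def)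
qed (simp_all add: conj_group_def gen_carrier)

text \<open>
  Since \<open>j \<notin> S\<close> and \<open>i \<notin> S\<close>, the second factor fixes both \<open>x_j\<close> and \<open>x_i\<close>, and hence the word
  \<open>x_j\<inverse> x_i x_j\<close> that the first factor produces from \<open>x_i\<close>.
\<close>

lemma part_conj_insert:
  assumes i: "i < n" and j: "j < n" "j \<notin> S" and ij: "i \<noteq> j" "i \<notin> S"
  shows "part_conj n (insert i S) j = eps n i j \<otimes>\<^bsub>conj_group n\<^esub> part_conj n S j"
proof (rule part_conj_eqI[symmetric, OF j(1)])
  interpret group "free_group n" by (rule group_free_group)
  interpret P: group_hom "free_group n" "free_group n" "part_conj n S j"
    using part_conj_hom[OF j(1)] by unfold_locales
  have e: "eps n i j = part_conj n {i} j" 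
    unfolding eps_def part_conj_def by (rule arg_cong[where f = "free_lift n"]) auto
  show "eps n i j \<otimes>\<^bsub>conj_group n\<^esub> part_conj n S j \<in> hom (free_group n) (free_group n)"
    by (simp add: conj_group_def e)
      (rule hom_compose[OF part_conj_hom[OF j(1)] part_conj_hom[OF j(1)]])
  show "eps n i j \<otimes>\<^bsub>conj_group n\<^esub> part_conj n S j \<in> extensional (carrier (free_group n))"
    by (simp add: conj_group_def)
  fix l assume "l < n"
  then show "(eps n i j \<otimes>\<^bsub>conj_group n\<^esub> part_conj n S j) (gen l) =
     (if l \<in> insert i S then inv\<^bsub>free_group n\<^esub> gen j \<otimes>\<^bsub>free_group n\<^esub> gen l \<otimes>\<^bsub>free_group n\<^esub> gen j else gen l)"
    using assms by (auto simp: conj_group_def e compose_def gen_carrier part_conj_gen)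
qed

lemma inner_gen_eq_part_conj:
  assumes j: "j < n"
  shows "inner n (gen j) = part_conj n ({..<n} - {j}) j"
proof (rule part_conj_eqI[OF j inner_hom[OF gen_carrier[OF j]]])
  interpret group "free_group n" by (rule group_free_group)
  show "inner n (gen j) \<in> extensional (carrier (free_group n))" by (simp add: inner_def)
  fix l assume "l < n"
  then show "inner n (gen j) (gen l) = (if l \<in> {..<n} - {j}
     then inv\<^bsub>free_group n\<^esub> gen j \<otimes>\<^bsub>free_group n\<^esub> gen l \<otimes>\<^bsub>free_group n\<^esub> gen j else gen l)"
    using j by (auto simp: inner_def gen_carrier)
qed

section \<open>The matrices of inner automorphisms\<close>

definition part_conj_mat :: "nat \<Rightarrow> nat set \<Rightarrow> nat \<Rightarrow> laurent mat" where
  "part_conj_mat n S j = mat n n (\<lambda>(r, c).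
     if r \<in> S then (if c = r then tpow (-1) else if c = j then 1 - tpow (-1) else 0)
     else (if c = r then 1 else 0))"

lemma part_conj_mat_carrier: "part_conj_mat n S j \<in> carrier_mat n n"
  by (simp add: part_conj_mat_def)

lemma part_conj_mat_mult_vec:
  assumes "j < n" "j \<notin> S" "r < n" "v \<in> carrier_vec n"
  shows "(part_conj_mat n S j *\<^sub>v v) $ r =
    (if r \<in> S then tpow (-1) * v $ r + (1 - tpow (-1)) * v $ j else v $ r)"
proof -
  have "(part_conj_mat n S j *\<^sub>v v) $ r = (\<Sum>c<n. part_conj_mat n S j $$ (r, c) * v $ c)"
    using assms by (auto simp: scalar_prod_def part_conj_mat_def lessThan_atLeast0 intro!: sum.cong)
  also have "\<dots> = (\<Sum>c<n. if r \<in> S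
      then (if c = r then tpow (-1) * v $ c else 0) + (if c = j then (1 - tpow (-1)) * v $ c else 0)
      else (if c = r then v $ c else 0))"
    using assms by (intro sum.cong) (auto simp: part_conj_mat_def)
  also have "\<dots> = (if r \<in> S then tpow (-1) * v $ r + (1 - tpow (-1)) * v $ j else v $ r)"
    using assms by (auto simp: sum.distrib)
  finally show ?thesis .
qed

text \<open>
  The left factor is the matrix for the singleton \<open>{i}\<close>, so its action on each column of the
  right factor is given by \<open>part_conj_mat_mult_vec\<close>.
\<close>

lemma part_conj_mat_insert:
  assumes "i < n" "j < n" "j \<notin> S" "i \<noteq> j" "i \<notin> S"
  shows "part_conj_mat n (insert i S) j = eps_mat n i j * part_conj_mat n S j"
proof (rule eq_matI)
  let ?M = "part_conj_mat n S j"
  have e: "eps_mat n i j = part_conj_mat n {i} j"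
    by (rule eq_matI) (auto simp: eps_mat_def part_conj_mat_def)
  fix r c assume "r < dim_row (eps_mat n i j * ?M)" "c < dim_col (eps_mat n i j * ?M)"
  then have rc: "r < n" "c < n" by (auto simp: eps_mat_def part_conj_mat_def)
  have "(eps_mat n i j * ?M) $$ (r, c) = (part_conj_mat n {i} j *\<^sub>v col ?M c) $ r"
    using rc by (simp add: e part_conj_mat_def)
  also have "\<dots> = (if r \<in> {i} then tpow (-1) * col ?M c $ r + (1 - tpow (-1)) * col ?M c $ j
      else col ?M c $ r)"
    using assms rc by (intro part_conj_mat_mult_vec) (auto simp: part_conj_mat_def)
  also have "\<dots> = part_conj_mat n (insert i S) j $$ (r, c)"
    using assms rc by (auto simp: part_conj_mat_def)
  finally show "part_conj_mat n (insert i S) j $$ (r, c) = (eps_mat n i j * ?M) $$ (r, c)" ..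
qed (auto simp: eps_mat_def part_conj_mat_def)

context
  fixes n :: nat and \<rho> :: "(letter list \<Rightarrow> letter list) \<Rightarrow> laurent mat"
  assumes \<rho>: "burau_bardakov n \<rho>"
begin

lemma burau_carrier: "\<phi> \<in> carrier (conj_group n) \<Longrightarrow> \<rho> \<phi> \<in> carrier_mat n n"
  using \<rho> by (auto simp: burau_bardakov_def GL_laurent_def units_of_def Units_def hom_def ring_mat_def)

lemma burau_mult:
  "\<phi> \<in> carrier (conj_group n) \<Longrightarrow> \<psi> \<in> carrier (conj_group n) \<Longrightarrow>
    \<rho> (\<phi> \<otimes>\<^bsub>conj_group n\<^esub> \<psi>) = \<rho> \<phi> * \<rho> \<psi>"
  using \<rho> by (auto simp: burau_bardakov_def GL_laurent_def units_of_def hom_def ring_mat_def)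

lemma burau_one: "\<rho> \<one>\<^bsub>conj_group n\<^esub> = 1\<^sub>m n"
proof -
  interpret R: ring "ring_mat TYPE(laurent) n ()" by (rule ring_mat)
  interpret group_hom "conj_group n" "GL_laurent n" \<rho>
    using \<rho> unfolding GL_laurent_def burau_bardakov_def
    by (simp add: group_hom_def group_hom_axioms_def group_conj_group R.units_group)
  show ?thesis using hom_one by (simp add: GL_laurent_def units_of_def ring_mat_def)
qed

lemma burau_part_conj:
  assumes j: "j < n" and "finite S" and "S \<subseteq> {..<n} - {j}"
  shows "part_conj n S j \<in> carrier (conj_group n) \<and> \<rho> (part_conj n S j) = part_conj_mat n S j"
  using assms(2,3)
proof (induction S)
  case empty
  have "1\<^sub>m n = part_conj_mat n {} j" by (rule eq_matI) (auto simp: part_conj_mat_def)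
  then show ?case using j group.is_monoid[OF group_conj_group]
    by (simp add: part_conj_empty burau_one monoid.one_closed)
next
  case (insert i S)
  have i: "i < n" "i \<noteq> j" "j \<notin> S" using insert.prems by auto
  have e: "eps n i j \<in> carrier (conj_group n)" "\<rho> (eps n i j) = eps_mat n i j"
    using \<rho> i j eps_conj_auto[of i n j] by (auto simp: burau_bardakov_def conj_group_def)
  show ?case
    using insert i j e group.is_monoid[OF group_conj_group]
    by (simp add: part_conj_insert burau_mult part_conj_mat_insert monoid.m_closed)
qed

lemma burau_inner_gen:
  "j < n \<Longrightarrow> \<rho> (inner n (gen j)) = part_conj_mat n ({..<n} - {j}) j"
  by (simp add: inner_gen_eq_part_conj burau_part_conj)

text \<open>
  The elements \<open>w\<close> for which this holds are closed under products and inverses, since \<open>inner\<close> and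
  \<open>\<rho>\<close> are homomorphisms.  It is therefore enough to look at a generator, whose matrix has row
  sums \<open>t\<inverse> + (1 - t\<inverse>)\<close> or \<open>1\<close>.
\<close>

lemma burau_inner_ones:
  assumes "w \<in> carrier (free_group n)"
  shows "\<rho> (inner n w) *\<^sub>v vec n (\<lambda>_. 1) = vec n (\<lambda>_. 1)"
proof -
  interpret group "free_group n" by (rule group_free_group)
  have mult: "\<rho> (inner n (u \<otimes>\<^bsub>free_group n\<^esub> v)) *\<^sub>v x = \<rho> (inner n u) *\<^sub>v (\<rho> (inner n v) *\<^sub>v x)"
    if "u \<in> carrier (free_group n)" "v \<in> carrier (free_group n)" "x \<in> carrier_vec n" for u v x
    using that by (simp add: inner_mult[symmetric] burau_mult inner_conj_group
        assoc_mult_mat_vec[OF burau_carrier burau_carrier])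
  have gen: "\<rho> (inner n (gen j)) *\<^sub>v vec n (\<lambda>_. 1) = vec n (\<lambda>_. 1)" if "j < n" for j
  proof (rule eq_vecI)
    fix r assume "r < dim_vec (vec n (\<lambda>_. 1 :: laurent))"
    then show "(\<rho> (inner n (gen j)) *\<^sub>v vec n (\<lambda>_. 1)) $ r = vec n (\<lambda>_. 1) $ r"
      using that by (simp add: burau_inner_gen part_conj_mat_mult_vec del: index_mult_mat_vec)
  qed (simp add: that burau_inner_gen part_conj_mat_def)
  have inv: "\<rho> (inner n (inv\<^bsub>free_group n\<^esub> gen j)) *\<^sub>v vec n (\<lambda>_. 1) = vec n (\<lambda>_. 1)" if j: "j < n" for j
    using mult[of "inv\<^bsub>free_group n\<^esub> gen j" "gen j" "vec n (\<lambda>_. 1)"] j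
    by (simp add: gen gen_carrier inner_one burau_one)
  from assms show ?thesis
  proof (induction w)
    case Nil
    then show ?case using inner_one[of n] burau_one by (simp add: free_group_def)
  next
    case (Cons a w)
    have a: "fst a < n" and w: "w \<in> carrier (free_group n)" and red: "reduced (a # w)"
      using Cons.prems by (auto simp: free_group_def reduced_Cons)
    have s: "[a] = gen (fst a) \<or> [a] = inv\<^bsub>free_group n\<^esub> gen (fst a)"
      using inv_gen[OF a] by (cases a) (auto simp: gen_def)
    then have c: "[a] \<in> carrier (free_group n)" using gen_carrier[OF a] by auto
    have "a # w = [a] \<otimes>\<^bsub>free_group n\<^esub> w"
      using cons_red_reduced[OF red] by (simp add: free_group_def)
    then show ?case using s a gen inv by (auto simp: mult[OF c w] Cons.IH[OF w])
  qed
qed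

text \<open>
  In a row \<open>r \<noteq> j\<close> the fixed point equation reads \<open>v_r = t\<inverse> v_r + (1 - t\<inverse>) v_j\<close>, which is
  \<open>(1 - t\<inverse>) (v_r - v_j) = 0\<close>, and \<open>1 - t\<inverse>\<close> is a nonzero element of an integral domain.
\<close>

lemma inner_fixed_vec_const:
  assumes j: "j < n" and v: "v \<in> carrier_vec n" and fix_v: "\<rho> (inner n (gen j)) *\<^sub>v v = v"
  shows "v = vec n (\<lambda>_. v $ j)"
proof (rule eq_vecI)
  fix r assume "r < dim_vec (vec n (\<lambda>_. v $ j))"
  then have r: "r < n" by simp
  have "Poly_Mapping.lookup (1 :: laurent) 0 \<noteq> Poly_Mapping.lookup (tpow (-1)) 0"
    by (simp add: tpow_def lookup_single)
  then have t: "(1 :: laurent) \<noteq> tpow (-1)" by metis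
  have "v $ r = v $ j"
  proof (cases "r = j")
    case False
    then have "v $ r = tpow (-1) * v $ r + (1 - tpow (-1)) * v $ j"
      using arg_cong[OF fix_v, of "\<lambda>u. u $ r"] r j v
      by (simp add: burau_inner_gen part_conj_mat_mult_vec del: index_mult_mat_vec)
    then have "(1 - tpow (-1)) * (v $ r - v $ j) = 0" by (simp add: algebra_simps)
    then show ?thesis using t by simp
  qed simp
  then show "v $ r = vec n (\<lambda>_. v $ j) $ r" using r by simp
qed (use v in simp)

text \<open>
  By normality, conjugation by \<open>x_0\<close> followed by \<open>\<phi>\<close> is \<open>\<phi>\<close> followed by conjugation by
  \<open>\<phi>(x_0)\<close>.  As the latter fixes the vector of ones, the image of this vector under \<open>\<rho> \<phi>\<close> is
  fixed by conjugation by \<open>x_0\<close>, and so is constant.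
\<close>

lemma burau_ones_eigenvector:
  assumes \<phi>: "\<phi> \<in> carrier (conj_group n)"
  shows "\<exists>c. \<rho> \<phi> *\<^sub>v vec n (\<lambda>_. 1) = vec n (\<lambda>_. c)"
proof (cases "n = 0")
  case True
  then show ?thesis using burau_carrier[OF \<phi>] by (auto intro!: eq_vecI)
next
  case False
  then have 0: "0 < n" and g: "gen 0 \<in> carrier (free_group n)" by (simp_all add: gen_carrier)
  let ?o = "vec n (\<lambda>_. 1) :: laurent vec"
  have \<phi>g: "\<phi> (gen 0) \<in> carrier (free_group n)"
    using \<phi> g by (auto simp: conj_group_def conj_auto_def auto_def hom_def)
  have "\<rho> (inner n (gen 0)) *\<^sub>v (\<rho> \<phi> *\<^sub>v ?o) = \<rho> (inner n (gen 0) \<otimes>\<^bsub>conj_group n\<^esub> \<phi>) *\<^sub>v ?o"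
    using \<phi> g by (simp add: burau_mult inner_conj_group assoc_mult_mat_vec[OF burau_carrier burau_carrier])
  also have "\<dots> = \<rho> \<phi> *\<^sub>v (\<rho> (inner n (\<phi> (gen 0))) *\<^sub>v ?o)"
    using \<phi> g \<phi>g by (simp add: inner_normal burau_mult inner_conj_group
        assoc_mult_mat_vec[OF burau_carrier burau_carrier])
  also have "\<dots> = \<rho> \<phi> *\<^sub>v ?o" by (simp add: burau_inner_ones[OF \<phi>g])
  finally show ?thesis
    using inner_fixed_vec_const[OF 0] mult_mat_vec_carrier[OF burau_carrier[OF \<phi>], of ?o] by auto
qed

end

section \<open>Reducibility\<close>

lemma to_fract_sum: "to_fract (sum f A) = (\<Sum>x\<in>A. to_fract (f x))"
  by (induction A rule: infinite_finite_induct) simp_all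

lemma subspace_const_vec:
  "VectorSpace.subspace (class_ring :: 'a :: field ring) {vec n (\<lambda>_. a) | a. True} (module_vec TYPE('a) n)"
  unfolding VectorSpace.subspace_def
proof (intro conjI vec_vs submodule.intro vec_module)
  fix v w :: "'a vec"
  assume "v \<in> {vec n (\<lambda>_. a) | a. True}" "w \<in> {vec n (\<lambda>_. a) | a. True}"
  then obtain a b where "v = vec n (\<lambda>_. a)" "w = vec n (\<lambda>_. b)" by auto
  then have "v + w = vec n (\<lambda>_. a + b)" by (auto intro!: eq_vecI)
  then show "v \<oplus>\<^bsub>module_vec TYPE('a) n\<^esub> w \<in> {vec n (\<lambda>_. a) | a. True}"
    by (auto simp: module_vec_simps)
next
  fix c :: 'a and v :: "'a vec"
  assume "v \<in> {vec n (\<lambda>_. a) | a. True}"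
  then obtain a where "v = vec n (\<lambda>_. a)" by auto
  then have "c \<cdot>\<^sub>v v = vec n (\<lambda>_. c * a)" by (auto intro!: eq_vecI)
  then show "c \<odot>\<^bsub>module_vec TYPE('a) n\<^esub> v \<in> {vec n (\<lambda>_. a) | a. True}"
    by (auto simp: module_vec_simps)
next
  have "0\<^sub>v n = vec n (\<lambda>_. 0 :: 'a)" by (auto intro!: eq_vecI)
  then show "\<zero>\<^bsub>module_vec TYPE('a) n\<^esub> \<in> {vec n (\<lambda>_. a) | a. True}"
    by (auto simp: module_vec_simps)
qed (auto simp: module_vec_simps)

lemma const_vec_invariant:
  fixes M :: "'a :: idom mat"
  assumes M: "M \<in> carrier_mat n n" and c: "M *\<^sub>v vec n (\<lambda>_. 1) = vec n (\<lambda>_. c)"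
  shows "map_mat to_fract M *\<^sub>v vec n (\<lambda>_. a) = vec n (\<lambda>_. to_fract c * a)"
proof (rule eq_vecI)
  fix r assume "r < dim_vec (vec n (\<lambda>_. to_fract c * a))"
  then have r: "r < n" by simp
  have "(\<Sum>k<n. M $$ (r, k)) = c"
    using arg_cong[OF c, of "\<lambda>v. v $ r"] r M by (simp add: scalar_prod_def lessThan_atLeast0)
  then have "(\<Sum>k<n. to_fract (M $$ (r, k)) * a) = to_fract c * a"
    by (simp add: to_fract_sum[symmetric] sum_distrib_right[symmetric])
  then show "(map_mat to_fract M *\<^sub>v vec n (\<lambda>_. a)) $ r = vec n (\<lambda>_. to_fract c * a) $ r"
    using r M by (simp add: scalar_prod_def lessThan_atLeast0)
qed (use M in simp)

theorem theorem6:
  fixes n :: nat and \<rho> :: "(letter list \<Rightarrow> letter list) \<Rightarrow> laurent mat"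
  assumes "n \<ge> 2" and "burau_bardakov n \<rho>"
  shows "reducible_rep n (conj_group n) \<rho>"
  unfolding reducible_rep_def
proof (intro exI[of _ "{vec n (\<lambda>_. a) | a. True}"] conjI ballI)
  let ?W = "{vec n (\<lambda>_. a) | a :: laurent fract. True}"
  show "VectorSpace.subspace class_ring ?W (module_vec TYPE(laurent fract) n)"
    by (rule subspace_const_vec)
  have "vec n (\<lambda>_. 1 :: laurent fract) $ 0 \<noteq> 0\<^sub>v n $ 0" using assms(1) by simp
  then have "vec n (\<lambda>_. 1 :: laurent fract) \<noteq> 0\<^sub>v n" by metis
  then show "?W \<noteq> {0\<^sub>v n}" by blast
  \<comment> \<open>The entries of \<open>unit_vec n 0\<close> at \<open>0\<close> and \<open>1\<close> differ; the index \<open>1\<close> exists because \<open>n \<ge> 2\<close>.\<close>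
  have "unit_vec n 0 \<noteq> vec n (\<lambda>_. a)" for a :: "laurent fract"
  proof
    assume "unit_vec n 0 = vec n (\<lambda>_. a)"
    then have "unit_vec n 0 $ 0 = (unit_vec n 0 :: laurent fract vec) $ 1" using assms(1) by simp
    then show False using assms(1) by simp
  qed
  then have "unit_vec n 0 \<notin> ?W" by blast
  then show "?W \<noteq> carrier_vec n" using unit_vec_carrier by metis
  fix \<phi> w assume \<phi>: "\<phi> \<in> carrier (conj_group n)" and "w \<in> ?W"
  then obtain a where w: "w = vec n (\<lambda>_. a)" by auto
  obtain c where "\<rho> \<phi> *\<^sub>v vec n (\<lambda>_. 1) = vec n (\<lambda>_. c)"
    using burau_ones_eigenvector[OF assms(2) \<phi>] by auto
  from const_vec_invariant[OF burau_carrier[OF assms(2) \<phi>] this, of a]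
  show "map_mat to_fract (\<rho> \<phi>) *\<^sub>v w \<in> ?W" unfolding w by auto
qed

end
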